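(* Let $\mathcal{S}$ be a nonempty set, let $\mathcal{B}$ be a scene space basis on $\mathcal{S}$, and let $\mathfrak{S}_{\mathcal{B}}$ be the scene space over $\mathcal{B}$. Then $\mathfrak{S}_{\mathcal{B}}$, ordered by the scene order $\le$, is a complete Boolean algebra in which the supremum of a subset $X \subseteq \mathfrak{S}_{\mathcal{B}}$ is $\bigcup X$ and the complement of $A \in \mathfrak{S}_{\mathcal{B}}$ is $A^{\complement}$.
   Context: Scenes. Let $\mathcal{S}$ be a nonempty set. A scene on $\mathcal{S}$ is a function $F:\mathcal{S}\to\mathcal{S}\to\mathcal{S}$ (its merge function) satisfying, for all $x,y,z\in\mathcal{S}$: $F\,(F\,x\,y)\,z = F\,x\,z$, $F\,x\,(F\,y\,z)=F\,x\,z$, and $F\,x\,x=x$. Operations: $\bot = (\lambda s_1\,s_2.\ s_1)$, $\top=(\lambda s_1\,s_2.\ s_2)$, $F^{\complement}=(\lambda s_1\,s_2.\ F\,s_2\,s_1)$, $F\sqcup G=(\lambda s_1\,s_2.\ G\,(F\,s_1\,s_2)\,s_2)$. Independence: scenes $F,G$ are independent if $G\,(F\,s_1\,s_2)\,s_3=F\,(G\,s_1\,s_3)\,s_2$ for all $s_1,s_2,s_3\in\mathcal{S}$. Scene order: $F\le G$ iff $F\,(G\,s_1\,s_2)\,s_3=G\,s_1\,(F\,s_2\,s_3)$ for all $s_1,s_2,s_3\in\mathcal{S}$. Scene space basis: a finite sequence of scenes $S_1,\dots,S_n$ on $\mathcal{S}$ such that $S_i$ and $S_j$ are independent whenever $i\ne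 j$, and $S_1\sqcup S_2\sqcup\cdots\sqcup S_n=\top$; write $\mathcal{B}=\{S_1,\dots,S_n\}$. Scene space: $\mathfrak{S}_{\mathcal{B}}$ is the smallest set of scenes on $\mathcal{S}$ that contains $\bot$ and every element of $\mathcal{B}$ and is closed under $\sqcup$; it is finite. For a finite set $X=\{A_1,\dots,A_m\}\subseteq\mathfrak{S}_{\mathcal{B}}$, $\bigcup X = A_1\sqcup\cdots\sqcup A_m$ (with $\bigcup\emptyset=\bot$); within a scene space the result does not depend on the order of enumeration. *)

theory Defs
  imports "HOL-Algebra.Complete_Lattice"
begin

section \<open>Scenes\<close>

text \<open>The nonempty set underlying the scenes is the type variable; types are nonempty in HOL.\<close>

type_synonym 's merge = "'s \<Rightarrow> 's \<Rightarrow> 's"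

definition scene :: "'s merge \<Rightarrow> bool" where
  "scene F \<longleftrightarrow> (\<forall>x y z. F (F x y) z = F x z \<and> F x (F y z) = F x z \<and> F x x = x)"

definition scene_bot :: "'s merge" where
  "scene_bot = (\<lambda>s\<^sub>1 s\<^sub>2. s\<^sub>1)"

definition scene_top :: "'s merge" where
  "scene_top = (\<lambda>s\<^sub>1 s\<^sub>2. s\<^sub>2)"

definition scene_compl :: "'s merge \<Rightarrow> 's merge" where
  "scene_compl F = (\<lambda>s\<^sub>1 s\<^sub>2. F s\<^sub>2 s\<^sub>1)"

definition scene_join :: "'s merge \<Rightarrow> 's merge \<Rightarrow> 's merge" where
  "scene_join F G = (\<lambda>s\<^sub>1 s\<^sub>2. G (F s\<^sub>1 s\<^sub>2) s\<^sub>2)"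

definition scene_indep :: "'s merge \<Rightarrow> 's merge \<Rightarrow> bool" where
  "scene_indep F G \<longleftrightarrow> (\<forall>s\<^sub>1 s\<^sub>2 s\<^sub>3. G (F s\<^sub>1 s\<^sub>2) s\<^sub>3 = F (G s\<^sub>1 s\<^sub>3) s\<^sub>2)"

definition scene_le :: "'s merge \<Rightarrow> 's merge \<Rightarrow> bool" where
  "scene_le F G \<longleftrightarrow> (\<forall>s\<^sub>1 s\<^sub>2 s\<^sub>3. F (G s\<^sub>1 s\<^sub>2) s\<^sub>3 = G s\<^sub>1 (F s\<^sub>2 s\<^sub>3))"

text \<open>\<open>scene_join\<close> is associative with neutral element \<open>scene_bot\<close> on all functions
  (\<open>scene_join_assoc\<close> below), so the bracketing of iterated joins is immaterial.\<close>

definition scene_Join :: "'s merge list \<Rightarrow> 's merge" where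
  "scene_Join Fs = foldl scene_join scene_bot Fs"

definition scene_basis :: "'s merge list \<Rightarrow> bool" where
  "scene_basis Bs \<longleftrightarrow>
    (\<forall>F \<in> set Bs. scene F) \<and>
    (\<forall>i < length Bs. \<forall>j < length Bs. i \<noteq> j \<longrightarrow> scene_indep (Bs ! i) (Bs ! j)) \<and>
    scene_Join Bs = scene_top"

text \<open>For arbitrary scenes the join need not be a scene. Over a basis all members of the
  following set are scenes; see \<open>scene_space_scene\<close> below.\<close>

inductive_set scene_space :: "'s merge set \<Rightarrow> 's merge set" for B where
  bot: "scene_bot \<in> scene_space B"
| basis: "F \<in> B \<Longrightarrow> F \<in> scene_space B"
| join: "F \<in> scene_space B \<Longrightarrow> G \<in> scene_space B \<Longrightarrow> scene_join F G \<in> scene_space B"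

text \<open>The enumeration of a finite set \<open>X\<close> is chosen arbitrarily; within a scene space over a
  basis every subset is finite and the choice is immaterial
  (\<open>finite_scene_space\<close>, \<open>scene_Union_set\<close> below).\<close>

definition scene_Union :: "'s merge set \<Rightarrow> 's merge" where
  "scene_Union X = scene_Join (SOME As. distinct As \<and> set As = X)"

definition scene_space_order :: "'s merge set \<Rightarrow> 's merge gorder" where
  "scene_space_order B = \<lparr>carrier = scene_space B, eq = (=), le = scene_le\<rparr>"


section \<open>Complete Boolean algebras with explicit carrier\<close>

definition is_complement :: "('a, 'b) gorder_scheme \<Rightarrow> 'a \<Rightarrow> 'a \<Rightarrow> bool" where
  "is_complement L x y \<longleftrightarrow>
    y \<in> carrier L \<and> x \<sqinter>\<^bsub>L\<^esub> y = \<bottom>\<^bsub>L\<^esub> \<and> x \<squnion>\<^bsub>L\<^esub> y = \<top>\<^bsub>L\<^esub>"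

text \<open>The one-element algebra is allowed.\<close>

locale complete_boolean_lattice = complete_lattice L for L (structure) +
  assumes meet_join_distrib:
      "\<lbrakk>x \<in> carrier L; y \<in> carrier L; z \<in> carrier L\<rbrakk> \<Longrightarrow> x \<sqinter> (y \<squnion> z) = (x \<sqinter> y) \<squnion> (x \<sqinter> z)"
    and complement_exists:
      "x \<in> carrier L \<Longrightarrow> \<exists>y. is_complement L x y"


section \<open>Well-definedness\<close>

lemma scene_join_assoc: "scene_join (scene_join F G) H = scene_join F (scene_join G H)"
  by (simp add: scene_join_def)

lemma scene_join_bot [simp]: "scene_join F scene_bot = F" "scene_join scene_bot F = F"
  by (simp_all add: scene_join_def scene_bot_def)

lemma scene_join_idem: "scene F \<Longrightarrow> scene_join F F = F"
  by (simp add: scene_join_def scene_def)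

lemma scene_bot_scene: "scene scene_bot"
  by (simp add: scene_def scene_bot_def)

lemma scene_join_scene:
  assumes F: "scene F" and G: "scene G" and comm: "scene_join F G = scene_join G F"
  shows "scene (scene_join F G)"
proof -
  have c: "G (F s a) a = F (G s a) a" for s a
    using comm by (metis scene_join_def)
  have F1: "F (F x y) z = F x z" "F x (F y z) = F x z" "F x x = x" for x y z
    using F by (auto simp: scene_def)
  have G1: "G (G x y) z = G x z" "G x (G y z) = G x z" "G x x = x" for x y z
    using G by (auto simp: scene_def)
  have "G (F (G (F x y) y) z) z = G (F x z) z" for x y z
    by (metis c F1(1) G1(1))
  moreover have "G (F x (G (F y z) z)) (G (F y z) z) = G (F x z) z" for x y z
    by (metis c F1(2) G1(2))
  ultimately show ?thesis
    by (simp add: scene_def scene_join_def F1 G1)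
qed

lemma scene_basis_comm:
  assumes "scene_basis Bs" "F \<in> set Bs" "G \<in> set Bs"
  shows "scene_join F G = scene_join G F"
proof -
  obtain i j where ij: "i < length Bs" "j < length Bs" "F = Bs ! i" "G = Bs ! j"
    using assms(2,3) by (metis in_set_conv_nth)
  show ?thesis
  proof (cases "i = j")
    case False
    then have "scene_indep F G"
      using assms(1) ij by (auto simp: scene_basis_def)
    then show ?thesis
      by (simp add: scene_indep_def scene_join_def)
  qed (simp add: ij)
qed

lemma scene_space_comm_basis:
  assumes "scene_basis Bs" "F \<in> scene_space (set Bs)" "G \<in> set Bs"
  shows "scene_join F G = scene_join G F"
  using assms(2)
proof induction
  case (join F F')
  then show ?case by (metis scene_join_assoc)
qed (use assms in \<open>auto intro: scene_basis_comm\<close>)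

lemma scene_space_comm:
  assumes "scene_basis Bs" "F \<in> scene_space (set Bs)" "G \<in> scene_space (set Bs)"
  shows "scene_join F G = scene_join G F"
  using assms(3)
proof induction
  case (join G G')
  then show ?case by (metis scene_join_assoc)
qed (use assms in \<open>auto intro: scene_space_comm_basis\<close>)

lemma scene_space_scene:
  assumes "scene_basis Bs" "F \<in> scene_space (set Bs)"
  shows "scene F"
  using assms(2)
proof induction
  case (basis F)
  then show ?case using assms(1) by (simp add: scene_basis_def)
next
  case (join F G)
  then show ?case using assms(1) by (auto intro: scene_join_scene scene_space_comm)
qed (rule scene_bot_scene)

lemma scene_Join_cong_set:
  assumes "scene_basis Bs" "set As \<subseteq> scene_space (set Bs)" "set As = set As'"
  shows "scene_Join As = scene_Join As'"
proof -
  interpret comp_fun_idem_on "scene_space (set Bs)" "\<lambda>F G. scene_join G F"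
  proof
    fix F G :: "'a merge"
    assume "F \<in> scene_space (set Bs)" "G \<in> scene_space (set Bs)"
    then have "scene_join F G = scene_join G F"
      using assms(1) scene_space_comm by blast
    then show "(\<lambda>H. scene_join H G) \<circ> (\<lambda>H. scene_join H F)
        = (\<lambda>H. scene_join H F) \<circ> (\<lambda>H. scene_join H G)"
      by (simp add: fun_eq_iff[where ?'a = "'a merge"] scene_join_assoc)
  next
    fix F :: "'a merge"
    assume "F \<in> scene_space (set Bs)"
    then have "scene_join F F = F"
      using assms(1) scene_space_scene scene_join_idem by blast
    then show "(\<lambda>H. scene_join H F) \<circ> (\<lambda>H. scene_join H F) = (\<lambda>H. scene_join H F)"
      by (simp add: fun_eq_iff[where ?'a = "'a merge"] scene_join_assoc)
  qed
  have "scene_Join Cs = Finite_Set.fold (\<lambda>F G. scene_join G F) scene_bot (set Cs)"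
    if "set Cs = set As" for Cs
    using that assms(2) fold_set_fold[of Cs scene_bot]
    by (simp add: scene_Join_def foldl_conv_fold)
  then show ?thesis using assms(3) by metis
qed

lemma scene_Join_append: "scene_Join (As @ As') = scene_join (scene_Join As) (scene_Join As')"
proof (induction As' rule: rev_induct)
  case (snoc A As')
  have "scene_Join (Cs @ [A]) = scene_join (scene_Join Cs) A" for Cs
    by (simp add: scene_Join_def)
  from this[of "As @ As'"] this[of As'] snoc show ?case by (simp add: scene_join_assoc)
qed (simp add: scene_Join_def)

lemma finite_scene_space:
  assumes "scene_basis Bs"
  shows "finite (scene_space (set Bs))"
proof -
  let ?D = "{Cs. set Cs \<subseteq> set Bs \<and> distinct Cs}"
  have "F \<in> scene_Join ` ?D" if "F \<in> scene_space (set Bs)" for F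
    using that
  proof induction
    case bot
    then show ?case by (auto simp: scene_Join_def intro!: image_eqI[of _ _ "[]"])
  next
    case (basis F)
    then show ?case by (auto simp: scene_Join_def intro!: image_eqI[of _ _ "[F]"])
  next
    case (join F G)
    then obtain As As' where *: "F = scene_Join As" "G = scene_Join As'"
      "set As \<subseteq> set Bs" "set As' \<subseteq> set Bs" by auto
    then have "scene_join F G = scene_Join (As @ As')"
      by (simp add: scene_Join_append)
    also have "\<dots> = scene_Join (remdups (As @ As'))"
      using * by (intro scene_Join_cong_set[OF assms])
        (auto intro: scene_space.basis simp del: remdups_append2)
    finally show ?case
      using * by (intro image_eqI[of _ _ "remdups (As @ As')"]) auto
  qed
  moreover have "finite ?D"
    by (rule finite_subset[OF _ finite_lists_length_le[of "set Bs" "card (set Bs)"]])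
      (auto simp flip: distinct_card intro: card_mono)
  ultimately show ?thesis
    by (meson finite_imageI finite_subset subsetI)
qed

lemma scene_Union_set:
  assumes "scene_basis Bs" "set As \<subseteq> scene_space (set Bs)"
  shows "scene_Union (set As) = scene_Join As"
proof -
  have "\<exists>Cs. distinct Cs \<and> set Cs = set As"
    by (metis finite_distinct_list finite_set)
  then have "set (SOME Cs. distinct Cs \<and> set Cs = set As) = set As"
    by (rule someI2_ex) simp
  then show ?thesis
    unfolding scene_Union_def using assms by (metis scene_Join_cong_set)
qed

end

theory Submission
  imports Defs
begin

text \<open>Any two scenes \<open>F\<close>, \<open>G\<close> of a scene space satisfy the entropic law
  \<open>F (G a b) (G c d) = G (F a c) (F b d)\<close>: it holds between basis scenes, and it says that each
  of them is a homomorphism for the other, so it is inherited by every term built from them. All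
  order-theoretic facts are then equational; in particular \<open>F \<le> G\<close> means \<open>G \<squnion> F = G\<close>, and the meet
  of \<open>F\<close> and \<open>G\<close> is \<open>\<lambda>s t. F s (G s t)\<close>. Closure under complements comes from the basis: an element
  is the union of a set \<open>I\<close> of basis scenes, the union of the remaining ones is independent of it and
  the two join to \<open>\<top>\<close>, which forces one to be the complement of the other.\<close>

section \<open>Independent scenes and uniqueness of complements\<close>

lemma sceneD:
  assumes "scene F"
  shows "F (F x y) z = F x z" "F x (F y z) = F x z" "F x x = x"
  using assms by (auto simp: scene_def)

lemma scene_indep_sym: "scene_indep F G \<Longrightarrow> scene_indep G F"
  by (simp add: scene_indep_def)

lemma scene_indep_join:
  "scene_indep F G \<Longrightarrow> scene_indep F H \<Longrightarrow> scene_indep F (scene_join G H)"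
  by (simp add: scene_indep_def scene_join_def)

lemma scene_indep_Join:
  "(\<And>G. G \<in> set Gs \<Longrightarrow> scene_indep F G) \<Longrightarrow> scene_indep F (scene_Join Gs)"
proof (induction Gs rule: rev_induct)
  case Nil
  show ?case by (simp add: scene_Join_def scene_indep_def scene_bot_def)
next
  case (snoc G Gs)
  then show ?case by (simp add: scene_Join_def scene_indep_join)
qed

text \<open>By independence \<open>F t u = F (G t t) u = G (F t u) t\<close>, and the outer
  \<open>G s\<close> sees only the last argument \<open>t\<close> of this.\<close>

lemma scene_indep_absorb:
  assumes "scene F" "scene G" "scene_indep F G"
  shows "G s (F t u) = G s t"
proof -
  have "F t u = G (F t u) t"
    using assms(3) by (simp add: scene_indep_def sceneD[OF assms(2)])
  then show ?thesis
    by (metis sceneD(2)[OF assms(2)])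
qed

text \<open>Recognises complements: to place \<open>scene_compl F\<close> in the scene space, it
  suffices to exhibit there an independent \<open>G\<close> that completes \<open>F\<close> to
  \<open>scene_top\<close>.\<close>

lemma scene_compl_unique:
  assumes "scene F" "scene G" "scene_indep F G" "scene_join F G = scene_top"
  shows "scene_compl F = G"
proof (intro ext)
  fix s t
  \<comment> \<open>Writing the first argument \<open>s\<close> of \<open>G s t\<close> in this form
    lets \<open>G\<close> discard the inner merge.\<close>
  have "G (F t s) s = s"
    using assms(4) by (metis scene_join_def scene_top_def)
  then have "G s t = G (F t s) t"
    by (metis sceneD(1)[OF assms(2)])
  also have "\<dots> = F t s"
    using assms(3) by (simp add: scene_indep_def sceneD[OF assms(2)])
  finally show "scene_compl F s t = G s t"
    by (simp add: scene_compl_def)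
qed

section \<open>Meets, the entropic law and the order\<close>

definition scene_meet :: "'s merge \<Rightarrow> 's merge \<Rightarrow> 's merge" where
  "scene_meet F G = (\<lambda>s t. F s (G s t))"

text \<open>De Morgan's law; it reduces closure under meets to closure under complements and
  joins.\<close>

lemma scene_meet_compl:
  "scene_meet F G = scene_compl (scene_join (scene_compl G) (scene_compl F))"
  by (simp add: scene_meet_def scene_compl_def scene_join_def)

definition entropic :: "'s merge \<Rightarrow> 's merge \<Rightarrow> bool" where
  "entropic F G \<longleftrightarrow> (\<forall>a b c d. F (G a b) (G c d) = G (F a c) (F b d))"

lemma entropic_sym: "entropic F G \<Longrightarrow> entropic G F"
  by (simp add: entropic_def)

lemma entropic_bot: "entropic F scene_bot"
  by (simp add: entropic_def scene_bot_def)

lemma entropic_join: "entropic F G \<Longrightarrow> entropic F H \<Longrightarrow> entropic F (scene_join G H)"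
  by (simp add: entropic_def scene_join_def)

lemma entropic_refl: "scene F \<Longrightarrow> entropic F F"
  by (simp add: entropic_def sceneD)

text \<open>By absorption neither side depends on \<open>d\<close>: they collapse to
  \<open>F (G a b) c\<close> and \<open>G (F a c) b\<close>, which independence equates.\<close>

lemma scene_indep_entropic:
  assumes "scene F" "scene G" "scene_indep F G"
  shows "entropic F G"
  unfolding entropic_def
proof (intro allI)
  fix a b c d
  have "F (G a b) (G c d) = F (G a b) c"
    by (rule scene_indep_absorb[OF assms(2,1) scene_indep_sym[OF assms(3)]])
  also have "\<dots> = G (F a c) b"
    using assms(3) by (simp add: scene_indep_def)
  also have "\<dots> = G (F a c) (F b d)"
    using assms by (simp add: scene_indep_absorb)
  finally show "F (G a b) (G c d) = G (F a c) (F b d)" .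
qed

lemma entropic_le_iff:
  assumes "scene F" "scene G" "entropic F G"
  shows "scene_le F G \<longleftrightarrow> scene_join G F = G"
proof
  assume "scene_le F G"
  then show "scene_join G F = G"
    by (simp add: scene_le_def scene_join_def sceneD[OF assms(1)])
next
  assume "scene_join G F = G"
  then have absorb: "F (G x y) y = G x y" for x y
    by (metis scene_join_def)
  have ent: "F (G a b) (G c d) = G (F a c) (F b d)" for a b c d
    using assms(3) by (simp add: entropic_def)
  \<comment> \<open>The entropic law turns the left side into \<open>F (G x w) (G z w)\<close>.
    Since \<open>G z w = F (G z w) w\<close> by \<open>absorb\<close>, this is
    \<open>F (G x w) w\<close>, hence \<open>G x w\<close>.\<close>
  have left: "G (F x z) w = G x w" for x z w
    by (metis absorb ent sceneD(2)[OF assms(1)] sceneD(2)[OF assms(2)])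
  show "scene_le F G"
    unfolding scene_le_def
  proof (intro allI)
    fix x y z
    have "F (G x y) z = F (G x y) (G z z)"
      by (simp add: sceneD[OF assms(2)])
    then show "F (G x y) z = G x (F y z)"
      by (simp add: ent left)
  qed
qed

lemma (in complete_lattice) meet_eqI:
  assumes "is_glb L m {x, y}" "x \<in> carrier L" "y \<in> carrier L"
  shows "x \<sqinter> y = m"
  using assms inf_of_two_greatest[of x y] greatest_unique unfolding meet_def by blast

lemma (in complete_lattice) join_eqI:
  assumes "is_lub L j {x, y}" "x \<in> carrier L" "y \<in> carrier L"
  shows "x \<squnion> y = j"
  using assms sup_of_two_least[of x y] least_unique unfolding join_def by blast

section \<open>The scene space over a fixed basis\<close>

locale scene_space_basis =
  fixes Bs :: "'s merge list"
  assumes basis: "scene_basis Bs"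
begin

abbreviation "Sp \<equiv> scene_space (set Bs)"

abbreviation "L \<equiv> scene_space_order (set Bs)"

lemma order_simps [simp]:
  "carrier L = Sp" "eq L = (=)" "le L = scene_le"
  by (simp_all add: scene_space_order_def)

lemma scene: "F \<in> Sp \<Longrightarrow> scene F"
  using basis by (rule scene_space_scene)

lemma join_comm: "F \<in> Sp \<Longrightarrow> G \<in> Sp \<Longrightarrow> scene_join F G = scene_join G F"
  using basis by (rule scene_space_comm)

lemma basis_indep:
  assumes "F \<in> set Bs" "G \<in> set Bs" "F \<noteq> G"
  shows "scene_indep F G"
  using basis assms unfolding scene_basis_def by (metis in_set_conv_nth)

text \<open>The first half of a double induction; \<open>entropic_space\<close> generalises the
  other argument by symmetry. The case \<open>F = G\<close> needs \<open>entropic_refl\<close>,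
  because independence is available only for distinct basis scenes.\<close>

lemma entropic_basis:
  assumes "F \<in> Sp" "G \<in> set Bs"
  shows "entropic G F"
  using assms(1)
proof induction
  case (basis F)
  show ?case
  proof (cases "F = G")
    case True
    then show ?thesis using assms(2) by (simp add: entropic_refl scene scene_space.basis)
  next
    case False
    then show ?thesis
      using assms(2) basis by (intro scene_indep_entropic basis_indep)
        (auto intro: scene scene_space.basis)
  qed
qed (auto intro: entropic_bot entropic_join)

lemma entropic_space:
  assumes "F \<in> Sp" "G \<in> Sp"
  shows "entropic F G"
  using assms(2)
proof induction
  case (basis G)
  then show ?case by (rule entropic_sym[OF entropic_basis[OF assms(1)]])
qed (auto intro: entropic_bot entropic_join)

lemma entropicD:
  "F \<in> Sp \<Longrightarrow> G \<in> Sp \<Longrightarrow> F (G a b) (G c d) = G (F a c) (F b d)"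
  using entropic_space[of F G] unfolding entropic_def by blast

lemma le_iff: "F \<in> Sp \<Longrightarrow> G \<in> Sp \<Longrightarrow> scene_le F G \<longleftrightarrow> scene_join G F = G"
  by (simp add: entropic_le_iff scene entropic_space)

section \<open>Joins of lists and closure under complements\<close>

lemma Join_closed: "set Fs \<subseteq> Sp \<Longrightarrow> scene_Join Fs \<in> Sp"
proof (induction Fs rule: rev_induct)
  case Nil
  show ?case by (simp add: scene_Join_def scene_space.bot)
next
  case (snoc F Fs)
  then show ?case by (simp add: scene_Join_def scene_space.join)
qed

lemma top_in: "scene_top \<in> Sp"
  using Join_closed[of Bs] basis by (auto simp: scene_basis_def intro: scene_space.basis)

lemma in_space_Join:
  assumes "F \<in> Sp"
  shows "\<exists>Fs. set Fs \<subseteq> set Bs \<and> F = scene_Join Fs"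
  using assms
proof induction
  case bot
  show ?case by (rule exI[of _ "[]"]) (simp add: scene_Join_def)
next
  case (basis F)
  then show ?case by (intro exI[of _ "[F]"]) (simp add: scene_Join_def)
next
  case (join F G)
  then obtain Fs Gs where "set Fs \<subseteq> set Bs" "F = scene_Join Fs" "set Gs \<subseteq> set Bs" "G = scene_Join Gs"
    by blast
  then show ?case by (intro exI[of _ "Fs @ Gs"]) (simp add: scene_Join_append)
qed

lemma compl_in:
  assumes "F \<in> Sp"
  shows "scene_compl F \<in> Sp"
proof -
  obtain Fs where Fs: "set Fs \<subseteq> set Bs" "F = scene_Join Fs"
    using in_space_Join[OF assms] by blast
  define Gs where "Gs = filter (\<lambda>G. G \<notin> set Fs) Bs"
  have sub: "set Bs \<subseteq> Sp" by (auto intro: scene_space.basis)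
  have G: "scene_Join Gs \<in> Sp"
    using sub by (intro Join_closed) (auto simp: Gs_def)
  have "scene_indep F H" if "H \<in> set Gs" for H
    using that Fs unfolding Fs(2)
    by (intro scene_indep_sym[OF scene_indep_Join] basis_indep) (auto simp: Gs_def)
  then have "scene_indep F (scene_Join Gs)"
    by (rule scene_indep_Join)
  moreover have "scene_join F (scene_Join Gs) = scene_top"
  proof -
    have "scene_join F (scene_Join Gs) = scene_Join (Fs @ Gs)"
      by (simp add: Fs(2) scene_Join_append)
    \<comment> \<open>\<open>Fs @ Gs\<close> and \<open>Bs\<close> may differ in order and
      repetitions, but have the same elements, and the join depends only on these.\<close>
    also have "\<dots> = scene_Join Bs"
      using Fs(1) sub by (intro scene_Join_cong_set[OF basis]) (auto simp: Gs_def)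
    finally show ?thesis using basis by (simp add: scene_basis_def)
  qed
  ultimately have "scene_compl F = scene_Join Gs"
    using assms G by (intro scene_compl_unique scene)
  then show ?thesis using G by simp
qed

lemma meet_in: "F \<in> Sp \<Longrightarrow> G \<in> Sp \<Longrightarrow> scene_meet F G \<in> Sp"
  unfolding scene_meet_compl by (intro compl_in scene_space.join)

section \<open>The order, suprema and infima\<close>

lemma partial_order: "partial_order L"
proof
  fix F G assume *: "F \<in> carrier L" "G \<in> carrier L" "F \<sqsubseteq>\<^bsub>L\<^esub> G" "G \<sqsubseteq>\<^bsub>L\<^esub> F"
  then show "F .=\<^bsub>L\<^esub> G" by (simp add: le_iff) (metis join_comm)
next
  fix F G H
  assume "F \<in> carrier L" "G \<in> carrier L" "H \<in> carrier L" "F \<sqsubseteq>\<^bsub>L\<^esub> G" "G \<sqsubseteq>\<^bsub>L\<^esub> H"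
  then show "F \<sqsubseteq>\<^bsub>L\<^esub> H" by (simp add: le_iff) (metis scene_join_assoc)
qed (auto simp: le_iff scene scene_join_idem)

sublocale partial_order L
  by (rule partial_order)

text \<open>Joining once more with a member leaves the set of joined scenes unchanged, hence also
  the join.\<close>

lemma Join_upper:
  assumes "set Fs \<subseteq> Sp" "F \<in> set Fs"
  shows "scene_le F (scene_Join Fs)"
proof -
  have "scene_join (scene_Join Fs) F = scene_Join (Fs @ [F])"
    by (simp add: scene_Join_def)
  also have "\<dots> = scene_Join Fs"
    using assms by (intro scene_Join_cong_set[OF basis]) auto
  finally show ?thesis using assms by (subst le_iff) (auto intro: Join_closed)
qed

lemma Join_least:
  assumes "set Fs \<subseteq> Sp" "G \<in> Sp" "\<And>F. F \<in> set Fs \<Longrightarrow> scene_le F G"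
  shows "scene_le (scene_Join Fs) G"
  using assms
proof (induction Fs rule: rev_induct)
  case Nil
  then show ?case by (simp add: scene_Join_def le_iff scene_space.bot)
next
  case (snoc F Fs)
  have *: "scene_Join (Fs @ [F]) = scene_join (scene_Join Fs) F"
    by (simp add: scene_Join_def)
  have "scene_join G (scene_Join Fs) = G" "scene_join G F = G"
    using snoc by (simp_all add: Join_closed flip: le_iff)
  then have "scene_join G (scene_join (scene_Join Fs) F) = G"
    by (metis scene_join_assoc)
  then show ?case
    using snoc.prems by (simp add: * le_iff Join_closed scene_space.join)
qed

lemma Union_lub:
  assumes "X \<subseteq> Sp"
  shows "is_lub L (scene_Union X) X"
proof -
  obtain Fs where X: "X = set Fs"
    using assms finite_scene_space[OF basis] by (metis finite_list finite_subset)
  have "scene_Union X = scene_Join Fs"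
    using scene_Union_set[OF basis] assms unfolding X by simp
  moreover have "is_lub L (scene_Join Fs) X"
    using assms unfolding X
    by (intro least_UpperI) (auto simp: Upper_def Join_upper Join_closed intro!: Join_least)
  ultimately show ?thesis by simp
qed

lemma join_lub:
  assumes "F \<in> Sp" "G \<in> Sp"
  shows "is_lub L (scene_join F G) {F, G}"
proof -
  have "scene_Join [F, G] = scene_join F G"
    by (simp add: scene_Join_def)
  then have "scene_Union {F, G} = scene_join F G"
    using scene_Union_set[OF basis, of "[F, G]"] assms by simp
  then show ?thesis using Union_lub[of "{F, G}"] assms by simp
qed

text \<open>Infima come from suprema: each member of \<open>X\<close> is an upper bound of the lower
  bounds of \<open>X\<close>, so it lies above their supremum.\<close>

lemma Union_lower_bounds_glb:
  assumes "X \<subseteq> Sp"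
  shows "is_glb L (scene_Union (Lower L X)) X"
proof -
  have lub: "is_lub L (scene_Union (Lower L X)) (Lower L X)"
    by (rule Union_lub) (use Lower_closed[of L X] in simp)
  show ?thesis
  proof (rule greatest_LowerI)
    fix F assume "F \<in> X"
    with assms have "F \<in> Upper L (Lower L X)"
      by (auto simp: Upper_def Lower_def)
    with lub show "scene_Union (Lower L X) \<sqsubseteq>\<^bsub>L\<^esub> F" by (rule least_le)
  next
    fix F assume "F \<in> Lower L X"
    then show "F \<sqsubseteq>\<^bsub>L\<^esub> scene_Union (Lower L X)"
      using lub by (intro least_Upper_above) (auto simp: Lower_def)
  qed (use assms lub in \<open>auto dest: least_closed\<close>)
qed

lemma meet_glb:
  assumes F: "F \<in> Sp" and G: "G \<in> Sp"
  shows "is_glb L (scene_meet F G) {F, G}"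
proof (rule greatest_LowerI)
  fix H assume "H \<in> {F, G}"
  moreover have "scene_join F (scene_meet F G) = F"
  proof (intro ext)
    fix s t
    have "G (F s t) t = F (G s t) t"
      using entropicD[OF F G, of s t t t] by (simp add: sceneD[OF scene[OF F]] sceneD[OF scene[OF G]])
    then show "scene_join F (scene_meet F G) s t = F s t"
      by (simp add: scene_join_def scene_meet_def sceneD[OF scene[OF F]])
  qed
  moreover have "scene_join G (scene_meet F G) = G"
    by (simp add: scene_join_def scene_meet_def sceneD[OF scene[OF G]] sceneD[OF scene[OF F]])
  ultimately show "scene_meet F G \<sqsubseteq>\<^bsub>L\<^esub> H"
    using F G meet_in by (auto simp: le_iff)
next
  fix H assume "H \<in> Lower L {F, G}"
  then have H: "H \<in> Sp" "scene_join F H = F" "scene_join G H = G"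
    using F G by (auto simp: Lower_def le_iff)
  \<comment> \<open>Commuting the joins puts \<open>H\<close> innermost, so that \<open>F\<close>
    and \<open>G\<close> can be seen to absorb a preceding merge by \<open>H\<close>.\<close>
  have "scene_join H F = F" "scene_join H G = G"
    using H F G join_comm by metis+
  then have *: "F (H a b) b = F a b" "G (H a b) b = G a b" for a b
    by (metis scene_join_def)+
  then have "F (H a b) c = F a c" for a b c
    by (metis sceneD(1) scene F)
  then have "scene_join H (scene_meet F G) = scene_meet F G"
    by (simp add: scene_join_def scene_meet_def *)
  then show "H \<sqsubseteq>\<^bsub>L\<^esub> scene_meet F G"
    using H(1) F G by (simp add: le_iff meet_in join_comm)
qed (use assms meet_in in auto)

section \<open>Lattice operations and the Boolean laws\<close>

lemma complete_lattice: "complete_lattice L"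
  by (rule complete_latticeI) (use Union_lub Union_lower_bounds_glb in auto)

sublocale complete_lattice L
  by (rule complete_lattice)

lemma meet_eq: "F \<in> Sp \<Longrightarrow> G \<in> Sp \<Longrightarrow> F \<sqinter>\<^bsub>L\<^esub> G = scene_meet F G"
  by (rule meet_eqI) (simp_all add: meet_glb)

lemma join_eq: "F \<in> Sp \<Longrightarrow> G \<in> Sp \<Longrightarrow> F \<squnion>\<^bsub>L\<^esub> G = scene_join F G"
  by (rule join_eqI) (simp_all add: join_lub)

lemma bottom_eq_bot: "\<bottom>\<^bsub>L\<^esub> = scene_bot"
  using bottom_weak_eq[of scene_bot] by (simp add: scene_space.bot le_iff)

lemma top_eq_top: "\<top>\<^bsub>L\<^esub> = scene_top"
proof -
  have "scene_le F scene_top" if "F \<in> Sp" for F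
    using that by (simp add: le_iff top_in)
      (simp add: scene_join_def scene_top_def sceneD[OF scene])
  then show ?thesis
    using top_weak_eq[of scene_top] by (simp add: top_in)
qed

lemma compl_is_complement:
  assumes "F \<in> Sp"
  shows "is_complement L F (scene_compl F)"
proof -
  have "scene_meet F (scene_compl F) = scene_bot" "scene_join F (scene_compl F) = scene_top"
    by (simp_all add: scene_meet_def scene_join_def scene_compl_def scene_bot_def scene_top_def
        sceneD[OF scene[OF assms]])
  then show ?thesis
    using assms by (simp add: is_complement_def meet_eq join_eq compl_in bottom_eq_bot top_eq_top)
qed

lemma scene_meet_join_distrib:
  assumes F: "F \<in> Sp" and H: "H \<in> Sp"
  shows "scene_meet F (scene_join G H) = scene_join (scene_meet F G) (scene_meet F H)"
proof (intro ext)
  fix s t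
  \<comment> \<open>Since \<open>t = F t t\<close>, the entropic law gives
    \<open>H (F s b) t = F (H s t) (H b t)\<close>, whose first argument is lost under
    \<open>F s\<close>. The law is used with \<open>b = G s t\<close>.\<close>
  have "F s (H (F s b) t) = F s (H b t)" for b
    using entropicD[OF H F, of s b t t] by (simp add: sceneD[OF scene[OF F]])
  then show "scene_meet F (scene_join G H) s t
      = scene_join (scene_meet F G) (scene_meet F H) s t"
    by (simp add: scene_meet_def scene_join_def sceneD[OF scene[OF F]])
qed

lemma complete_boolean_lattice: "complete_boolean_lattice L"
proof
  fix F G H assume "F \<in> carrier L" "G \<in> carrier L" "H \<in> carrier L"
  then show "F \<sqinter>\<^bsub>L\<^esub> (G \<squnion>\<^bsub>L\<^esub> H) = F \<sqinter>\<^bsub>L\<^esub> G \<squnion>\<^bsub>L\<^esub> (F \<sqinter>\<^bsub>L\<^esub> H)"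
    by (simp add: meet_eq join_eq meet_in scene_space.join scene_meet_join_distrib)
qed (use compl_is_complement in auto)

end

theorem theorem26:
  fixes Bs :: "'s merge list"
  assumes "scene_basis Bs"
  shows "complete_boolean_lattice (scene_space_order (set Bs)) \<and>
    (\<forall>X. X \<subseteq> scene_space (set Bs) \<longrightarrow>
      is_lub (scene_space_order (set Bs)) (scene_Union X) X) \<and>
    (\<forall>A \<in> scene_space (set Bs).
      is_complement (scene_space_order (set Bs)) A (scene_compl A))"
proof -
  interpret scene_space_basis Bs
    using assms by unfold_locales
  show ?thesis
    using complete_boolean_lattice Union_lub compl_is_complement by blast
qed

end
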